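(* Assume that $f(\rho)=\operatorname{Tr}[\rho\,\Omega(\rho)]$ is convex and differentiable on $\mathcal M$, and let $\rho^*\in\mathcal M_{++}$ be an AB fixed point, i.e. $\mathcal T_{AB}(\rho^* )=\rho^*$. Assume $\Omega$ is differentiable at $\rho^*$ along directions in $T_{\mathcal M}$. Let $E_1,\dots,E_m$, $m=d^2-k-1$, be a Hilbert–Schmidt orthonormal basis of $T_{\mathcal M}$. Then the following conditions are equivalent: (d1) $\rho^*$ is a global minimizer of $f$ over $\mathcal M$; (d2) $Df(\rho^* )[X]=0$ for all $X\in T_{\mathcal M}$; (d3) $\operatorname{Tr}(\rho^*\,D\Omega(\rho^* )[X])=0$ for all $X\in T_{\mathcal M}$; (d4) $\operatorname{Tr}(\rho^*\,D\Omega(\rho^* )[E_a])=0$ for $a=1,\dots,m$.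
   Context: $\mathcal H$ is a complex Hilbert space of finite dimension $d$, $\mathcal B(\mathcal H)$ the real space of Hermitian operators with Hilbert–Schmidt inner product $\langle X,Y\rangle=\operatorname{Tr}(XY)$, $\mathcal S(\mathcal H)$ the set of density operators. $H_1,\dots,H_k\in\mathcal B(\mathcal H)$ and $c\in\mathbb R^k$ are given, with $\{I,H_1,\dots,H_k\}$ linearly independent, and $\mathcal M=\{\rho\in\mathcal S(\mathcal H):\operatorname{Tr}(\rho H_j)=c_j,\ j=1,\dots,k\}$ is assumed to contain a positive-definite state; $\mathcal M_{++}=\{\rho\in\mathcal M:\rho\succ0\}$. $T_{\mathcal M}=\{X\in\mathcal B(\mathcal H):\operatorname{Tr}X=0,\ \operatorname{Tr}(XH_j)=0\ \forall j\}$. $\Omega:\mathcal S(\mathcal H)\to\mathcal B(\mathcal H)$ is continuous, and $\gamma>0$. Differentiability of $f$ is relative to the affine hull of $\mathcal M$. $Df(\rho)[X]$ and $D\Omega(\rho)[X]$ denote directional derivatives in direction $X\in T_{\mathcal M}$. $D(\sigma\|\rho)=\operatorname{Tr}\,\sigma(\log\sigma-\log\rho)$ (with $0\log0=0$). For $\rho\in\mathcal M_{++}$ the Arimoto–Blahut (AB) map is $\mathcal T_{AB}(\rho)=\arg\min_{\sigma\in\mathcal M}D(\sigma\|\mathcal F_3[\rho])$, where $\mathcal F_3[\rho]=\exp(\log\rho-\tfrac1\gamma\Omega(\rho))/\operatorname{Tr}\exp(\log\rho-\tfrac1\gamma\Omega(\rho))$. *)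

theory Defs
  imports "HOL-Analysis.Analysis"
begin

text \<open>The Hilbert space of dimension \<open>d\<close> is rendered as \<open>complex ^ 'n\<close> with \<open>d = CARD('n)\<close>, and
  operators as square complex matrices; multiplication of operators is \<open>**\<close> (the type class
  operation \<open>*\<close> on vectors acts componentwise).\<close>

definition adjoint_mat :: "complex ^ 'n ^ 'n \<Rightarrow> complex ^ 'n ^ 'n" where
  "adjoint_mat A = (\<chi> i j. cnj (A $ j $ i))"

definition hermitian :: "complex ^ 'n ^ 'n \<Rightarrow> bool" where
  "hermitian A \<longleftrightarrow> adjoint_mat A = A"

definition unitary :: "complex ^ 'n ^ 'n \<Rightarrow> bool" where
  "unitary U \<longleftrightarrow> adjoint_mat U ** U = mat 1 \<and> U ** adjoint_mat U = mat 1"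

definition real_diag :: "real ^ 'n \<Rightarrow> complex ^ 'n ^ 'n" where
  "real_diag l = (\<chi> i j. if i = j then complex_of_real (l $ i) else 0)"

text \<open>The inner product \<open>\<bullet>\<close> of \<open>complex ^ 'n\<close> is the real part of the Hermitian inner product;
  the latter is real on the quadratic form of a Hermitian matrix.\<close>

definition pos_semidef :: "complex ^ 'n ^ 'n \<Rightarrow> bool" where
  "pos_semidef A \<longleftrightarrow> hermitian A \<and> (\<forall>v. 0 \<le> v \<bullet> (A *v v))"

definition pos_def :: "complex ^ 'n ^ 'n \<Rightarrow> bool" where
  "pos_def A \<longleftrightarrow> hermitian A \<and> (\<forall>v. v \<noteq> 0 \<longrightarrow> 0 < v \<bullet> (A *v v))"

definition states :: "(complex ^ 'n ^ 'n) set" where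
  "states = {\<rho>. pos_semidef \<rho> \<and> trace \<rho> = 1}"

text \<open>Traces of products of two Hermitian matrices are real; \<open>Re\<close> only changes the type.\<close>

definition hs_inner :: "complex ^ 'n ^ 'n \<Rightarrow> complex ^ 'n ^ 'n \<Rightarrow> real" where
  "hs_inner X Y = Re (trace (X ** Y))"

text \<open>Functional calculus for Hermitian matrices, \<open>g(U diag(l) U*) = U diag(g(l)) U*\<close>. The value
  does not depend on the diagonalization chosen, so the description is definite.\<close>

definition herm_fun :: "(real \<Rightarrow> real) \<Rightarrow> complex ^ 'n ^ 'n \<Rightarrow> complex ^ 'n ^ 'n" where
  "herm_fun g A = (THE B. \<exists>U l. unitary U \<and> A = U ** real_diag l ** adjoint_mat U \<and>
     B = U ** real_diag (\<chi> i. g (l $ i)) ** adjoint_mat U)"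

abbreviation mat_exp :: "complex ^ 'n ^ 'n \<Rightarrow> complex ^ 'n ^ 'n" where
  "mat_exp \<equiv> herm_fun exp"

abbreviation mat_log :: "complex ^ 'n ^ 'n \<Rightarrow> complex ^ 'n ^ 'n" where
  "mat_log \<equiv> herm_fun ln"

text \<open>\<open>D(\<sigma>\<parallel>\<rho>)\<close> for a state \<open>\<sigma>\<close> and a positive definite \<open>\<rho>\<close>. If \<open>\<sigma>\<close> is singular, the value of
  \<open>ln 0\<close> is multiplied by a zero eigenvalue of \<open>\<sigma>\<close>, which realizes the convention \<open>0 log 0 = 0\<close>.\<close>

definition rel_entropy :: "complex ^ 'n ^ 'n \<Rightarrow> complex ^ 'n ^ 'n \<Rightarrow> real" where
  "rel_entropy \<sigma> \<rho> = Re (trace (\<sigma> ** (mat_log \<sigma> - mat_log \<rho>)))"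

definition feasible ::
  "nat \<Rightarrow> (nat \<Rightarrow> complex ^ 'n ^ 'n) \<Rightarrow> (nat \<Rightarrow> real) \<Rightarrow> (complex ^ 'n ^ 'n) set" where
  "feasible k H c = {\<rho> \<in> states. \<forall>j\<in>{1..k}. trace (\<rho> ** H j) = complex_of_real (c j)}"

definition feasible_pos ::
  "nat \<Rightarrow> (nat \<Rightarrow> complex ^ 'n ^ 'n) \<Rightarrow> (nat \<Rightarrow> real) \<Rightarrow> (complex ^ 'n ^ 'n) set" where
  "feasible_pos k H c = {\<rho> \<in> feasible k H c. pos_def \<rho>}"

definition tangent :: "nat \<Rightarrow> (nat \<Rightarrow> complex ^ 'n ^ 'n) \<Rightarrow> (complex ^ 'n ^ 'n) set" where
  "tangent k H = {X. hermitian X \<and> trace X = 0 \<and> (\<forall>j\<in>{1..k}. trace (X ** H j) = 0)}"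

definition hs_orthonormal_basis ::
  "nat \<Rightarrow> (nat \<Rightarrow> complex ^ 'n ^ 'n) \<Rightarrow> (complex ^ 'n ^ 'n) set \<Rightarrow> bool" where
  "hs_orthonormal_basis m E V \<longleftrightarrow>
     (\<forall>a\<in>{1..m}. \<forall>b\<in>{1..m}. hs_inner (E a) (E b) = (if a = b then 1 else 0)) \<and>
     span (E ` {1..m}) = V"

definition objective :: "(complex ^ 'n ^ 'n \<Rightarrow> complex ^ 'n ^ 'n) \<Rightarrow> complex ^ 'n ^ 'n \<Rightarrow> real" where
  "objective \<Omega> \<rho> = Re (trace (\<rho> ** \<Omega> \<rho>))"

text \<open>For \<open>\<rho>\<close> positive definite and feasible and \<open>X\<close> in the tangent space, \<open>\<rho> + t X\<close> is feasible for
  all \<open>t\<close> near 0, so the two-sided derivative at \<open>t = 0\<close> only involves values at states.\<close>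

definition dir_deriv ::
  "(complex ^ 'n ^ 'n \<Rightarrow> 'b::real_normed_vector) \<Rightarrow> complex ^ 'n ^ 'n \<Rightarrow> complex ^ 'n ^ 'n \<Rightarrow> 'b" where
  "dir_deriv F \<rho> X = vector_derivative (\<lambda>t. F (\<rho> + t *\<^sub>R X)) (at 0)"

definition dir_differentiable ::
  "(complex ^ 'n ^ 'n \<Rightarrow> 'b::real_normed_vector) \<Rightarrow> complex ^ 'n ^ 'n \<Rightarrow> complex ^ 'n ^ 'n \<Rightarrow> bool" where
  "dir_differentiable F \<rho> X \<longleftrightarrow> (\<lambda>t::real. F (\<rho> + t *\<^sub>R X)) differentiable (at 0)"

definition AB_target ::
  "real \<Rightarrow> (complex ^ 'n ^ 'n \<Rightarrow> complex ^ 'n ^ 'n) \<Rightarrow> complex ^ 'n ^ 'n \<Rightarrow> complex ^ 'n ^ 'n" where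
  "AB_target \<gamma> \<Omega> \<rho> =
     (let A = mat_exp (mat_log \<rho> - (1 / \<gamma>) *\<^sub>R \<Omega> \<rho>) in (1 / Re (trace A)) *\<^sub>R A)"

definition AB_map ::
  "nat \<Rightarrow> (nat \<Rightarrow> complex ^ 'n ^ 'n) \<Rightarrow> (nat \<Rightarrow> real) \<Rightarrow> real \<Rightarrow>
   (complex ^ 'n ^ 'n \<Rightarrow> complex ^ 'n ^ 'n) \<Rightarrow> complex ^ 'n ^ 'n \<Rightarrow> complex ^ 'n ^ 'n" where
  "AB_map k H c \<gamma> \<Omega> \<rho> =
     arg_min (\<lambda>\<sigma>. rel_entropy \<sigma> (AB_target \<gamma> \<Omega> \<rho>)) (\<lambda>\<sigma>. \<sigma> \<in> feasible k H c)"

end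

theory Submission
  imports Defs
begin

text \<open>The fixed point \<open>\<rho>*\<close> minimizes \<open>D(\<sigma> \<parallel> F)\<close> over the feasible set, where
  \<open>log F = log \<rho>* - \<Omega>(\<rho>*) / \<gamma> - const \<sqdot> I\<close>. As \<open>\<rho>*\<close> is an interior point, first-order optimality
  makes \<open>log \<rho>* - log F\<close>, and hence \<open>\<Omega>(\<rho>*)\<close>, orthogonal to the tangent space. The product rule
  then reduces \<open>Df(\<rho>*)[X]\<close> to \<open>Tr (\<rho>* D\<Omega>(\<rho>*)[X])\<close>. In particular the latter is linear in \<open>X\<close>,
  although \<open>\<Omega>\<close> itself is only directionally differentiable.\<close>

section \<open>Adjoints and the spectral theorem\<close>

text \<open>The fixed-point hypothesis carries information only once two descriptions are under
  control. For \<open>herm_fun\<close>, a diagonalization has to exist and its choice must not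
  matter. For \<open>arg_min\<close>, the minimum has to be attained, so the feasible set must be
  compact and the relative entropy continuous up to singular states, near which
  \<open>mat_log\<close> itself blows up. The spectral theorem and the continuity of the functional
  calculus serve these two ends; the continuity is used once more for the logarithm along a line
  through the fixed point. Positive definiteness of the fixed point makes every tangent line
  two-sided near 0, and convexity of \<open>f\<close> enters in the step from (d2) to (d1).\<close>

lemma adjoint_mat_nth [simp]: "adjoint_mat A $ i $ j = cnj (A $ j $ i)"
  by (simp add: adjoint_mat_def)

lemma adjoint_mat_adjoint_mat [simp]: "adjoint_mat (adjoint_mat A) = A"
  by (simp add: vec_eq_iff)

lemma adjoint_mat_mult: "adjoint_mat (A ** B) = adjoint_mat B ** adjoint_mat A"
  by (simp add: vec_eq_iff matrix_matrix_mult_def mult.commute)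

lemma adjoint_mat_add: "adjoint_mat (A + B) = adjoint_mat A + adjoint_mat B"
  by (simp add: vec_eq_iff)

lemma adjoint_mat_diff: "adjoint_mat (A - B) = adjoint_mat A - adjoint_mat B"
  by (simp add: vec_eq_iff)

lemma adjoint_mat_scaleR: "adjoint_mat (r *\<^sub>R A) = r *\<^sub>R adjoint_mat A"
  by (simp add: vec_eq_iff)

lemma adjoint_mat_real_diag [simp]: "adjoint_mat (real_diag l) = real_diag l"
  by (auto simp: vec_eq_iff real_diag_def)

lemma inner_matrix_vector_mult:
  "(x :: complex ^ 'n) \<bullet> (A *v y) = (adjoint_mat A *v x) \<bullet> y"
proof -
  have "x \<bullet> (A *v y) = (\<Sum>i\<in>UNIV. \<Sum>j\<in>UNIV. x $ i \<bullet> (A $ i $ j * y $ j))"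
    by (simp add: inner_vec_def matrix_vector_mult_def inner_sum_right)
  also have "\<dots> = (\<Sum>j\<in>UNIV. \<Sum>i\<in>UNIV. (cnj (A $ i $ j) * x $ i) \<bullet> y $ j)"
    by (subst sum.swap) (simp add: inner_complex_def algebra_simps)
  also have "\<dots> = (adjoint_mat A *v x) \<bullet> y"
    by (simp add: inner_vec_def matrix_vector_mult_def inner_sum_left)
  finally show ?thesis .
qed

text \<open>The real inner product cannot express complex orthogonality: a vector and its multiple
  by the imaginary unit are orthogonal for \<open>\<bullet>\<close>. The columns of a unitary matrix
  need the full Hermitian form.\<close>

definition cdot :: "complex ^ 'n \<Rightarrow> complex ^ 'n \<Rightarrow> complex" where
  "cdot u v = (\<Sum>i\<in>UNIV. cnj (u $ i) * v $ i)"

lemma cdot_add: "cdot u (v + w) = cdot u v + cdot u w"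
  by (simp add: cdot_def algebra_simps sum.distrib)

lemma cdot_scaleR: "cdot u (r *\<^sub>R v) = r *\<^sub>R cdot u v"
  by (simp add: cdot_def scaleR_sum_right)

lemma cdot_scaleR_left: "cdot (r *\<^sub>R u) v = r *\<^sub>R cdot u v"
  by (simp add: cdot_def scaleR_sum_right)

lemma cdot_self: "cdot v v = complex_of_real ((norm v)\<^sup>2)"
  unfolding power2_norm_eq_inner
  by (simp add: cdot_def inner_vec_def complex_eq_iff inner_complex_def)

lemma cnj_cdot: "cnj (cdot u v) = cdot v u"
  by (simp add: cdot_def mult.commute)

lemma cdot_mult: "cdot u (A *v v) = cdot (adjoint_mat A *v u) v"
proof -
  have "cdot u (A *v v) = (\<Sum>i\<in>UNIV. \<Sum>j\<in>UNIV. cnj (u $ i) * (A $ i $ j * v $ j))"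
    by (simp add: cdot_def matrix_vector_mult_def sum_distrib_left)
  also have "\<dots> = (\<Sum>j\<in>UNIV. \<Sum>i\<in>UNIV. cnj (cnj (A $ i $ j) * u $ i) * v $ j)"
    by (subst sum.swap) (simp add: algebra_simps)
  also have "\<dots> = cdot (adjoint_mat A *v u) v"
    by (simp add: cdot_def matrix_vector_mult_def sum_distrib_right)
  finally show ?thesis .
qed

lemma matrix_vector_mult_scaleR_right: "(A :: complex^'n^'n) *v (r *\<^sub>R v) = r *\<^sub>R (A *v v)"
  by (simp add: vec_eq_iff matrix_vector_mult_def scaleR_sum_right)

text \<open>A dimension count without dimensions: the linear map \<open>f\<close> sends
  \<open>complex ^ 'n\<close> into itself and its component \<open>i\<close> is always 0, so it is
  not surjective, hence not injective, and any nonzero kernel vector will do.\<close>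

lemma exists_orthogonal:
  fixes u :: "'n::finite \<Rightarrow> complex ^ 'n"
  assumes "i \<notin> S"
  shows "\<exists>v. v \<noteq> 0 \<and> (\<forall>j\<in>S. cdot (u j) v = 0)"
proof -
  define f where "f v = (\<chi> j. if j \<in> S then cdot (u j) v else 0)" for v
  have lin: "linear f"
    by (auto simp: linear_iff f_def vec_eq_iff cdot_add cdot_scaleR)
  have "f v \<noteq> axis i 1" for v
    using assms by (auto simp: f_def vec_eq_iff axis_def intro!: exI[of _ i])
  then have "\<not> surj f"
    by (metis surjD)
  then have "\<not> inj f"
    using lin linear_injective_imp_surjective by blast
  then obtain v where "v \<noteq> 0" "f v = 0"
    using lin linear_injective_0 by blast
  then show ?thesis
    by (auto simp: f_def vec_eq_iff intro!: exI[of _ v]) metis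
qed

text \<open>At a maximizer \<open>v\<close> of \<open>v \<bullet> Av\<close> on the unit sphere of \<open>W\<close>, perturbation in the direction of the
  residual \<open>w = Av - lv\<close> forces \<open>w = 0\<close>.\<close>

lemma rayleigh_eigenvector:
  fixes A :: "complex ^ 'n ^ 'n"
  assumes herm: "hermitian A" and W: "subspace W" and inv: "\<And>w. w \<in> W \<Longrightarrow> A *v w \<in> W"
    and v0: "v0 \<in> W" "v0 \<noteq> 0"
  shows "\<exists>v l. v \<in> W \<and> norm v = 1 \<and> A *v v = l *\<^sub>R v"
proof -
  let ?q = "\<lambda>v. v \<bullet> (A *v v)"
  let ?K = "W \<inter> sphere 0 1"
  have "compact ?K"
    using closed_subspace[OF W] by (simp add: closed_Int_compact)
  moreover have "(1 / norm v0) *\<^sub>R v0 \<in> ?K"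
    using v0 W by (simp add: subspace_scale)
  then have "?K \<noteq> {}" by blast
  moreover have "continuous_on ?K ?q"
    unfolding matrix_vector_mult_def
    by (intro continuous_intros)
  ultimately obtain v where v: "v \<in> ?K" "\<And>w. w \<in> ?K \<Longrightarrow> ?q w \<le> ?q v"
    using continuous_attains_sup[of ?K ?q] by metis
  define l where "l = ?q v"
  have bound: "?q w \<le> l * (norm w)\<^sup>2" if "w \<in> W" for w
  proof (cases "w = 0")
    case False
    let ?w = "(1 / norm w) *\<^sub>R w"
    have "?q ?w \<le> l"
      using that False W v(2)[of ?w] by (simp add: subspace_scale l_def)
    then show ?thesis
      using False by (simp add: matrix_vector_mult_scaleR_right field_simps power2_eq_square)
  qed simp
  define w where "w = A *v v - l *\<^sub>R v"
  have vW: "v \<in> W" and v1: "norm v = 1"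
    using v(1) by auto
  have wW: "w \<in> W"
    unfolding w_def using vW W inv by (simp add: subspace_diff subspace_scale)
  have sym: "v \<bullet> (A *v w) = w \<bullet> (A *v v)"
    using herm by (metis inner_matrix_vector_mult hermitian_def inner_commute)
  have vv: "v \<bullet> v = 1"
    using v1 by (simp add: norm_eq_1)
  \<comment> \<open>Insert \<open>v + t *\<^sub>R w\<close> into \<open>bound\<close>. The terms of
    order 0 agree because \<open>v\<close> has norm 1, and the difference of the first-order terms
    is 2t times \<open>w \<bullet> (A *v v - l *\<^sub>R v)\<close>, which is
    \<open>w \<bullet> w\<close>.\<close>
  have key: "2 * t * (w \<bullet> w) \<le> t\<^sup>2 * (l * (w \<bullet> w) - ?q w)" for t
  proof -
    have "?q (v + t *\<^sub>R w) \<le> l * (norm (v + t *\<^sub>R w))\<^sup>2"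
      using bound vW wW W by (simp add: subspace_add subspace_scale)
    also have "?q (v + t *\<^sub>R w) = l + 2 * t * (w \<bullet> (A *v v)) + t\<^sup>2 * ?q w"
      using sym by (simp add: matrix_vector_right_distrib matrix_vector_mult_scaleR_right
          inner_add_left inner_add_right l_def power2_eq_square algebra_simps)
    also have "(norm (v + t *\<^sub>R w))\<^sup>2 = 1 + 2 * t * (w \<bullet> v) + t\<^sup>2 * (w \<bullet> w)"
      unfolding power2_norm_eq_inner using vv
      by (simp add: inner_add_left inner_add_right power2_eq_square inner_commute algebra_simps)
    finally have "2 * t * (w \<bullet> (A *v v)) - 2 * t * (l * (w \<bullet> v)) \<le> t\<^sup>2 * (l * (w \<bullet> w) - ?q w)"
      by (simp add: algebra_simps)
    moreover have "w \<bullet> (A *v v) - l * (w \<bullet> v) = w \<bullet> w"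
      by (simp add: w_def inner_diff_right)
    then have "2 * t * (w \<bullet> (A *v v)) - 2 * t * (l * (w \<bullet> v)) = 2 * t * (w \<bullet> w)"
      by (metis (no_types, lifting) mult.assoc right_diff_distrib)
    ultimately show ?thesis by simp
  qed
  \<comment> \<open>The summand 1 keeps \<open>C\<close> positive for the division. With t = |w|^2 /
    C, \<open>key\<close> becomes 2 |w|^4 / C \<le> |w|^4 / C, which forces w = 0.\<close>
  define C where "C = \<bar>l * (w \<bullet> w) - ?q w\<bar> + 1"
  have C: "C > 0" "l * (w \<bullet> w) - ?q w \<le> C"
    by (auto simp: C_def)
  define t where "t = (w \<bullet> w) / C"
  have "2 * t * (w \<bullet> w) \<le> t\<^sup>2 * (l * (w \<bullet> w) - ?q w)" 
    by (rule key)
  also have "\<dots> \<le> t\<^sup>2 * C"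
    using C by (intro mult_left_mono) auto
  also have "\<dots> = t * (w \<bullet> w)"
    using C by (simp add: t_def power2_eq_square)
  finally have "(w \<bullet> w)\<^sup>2 / C \<le> 0"
    by (simp add: t_def power2_eq_square)
  then have "w \<bullet> w = 0"
    using C by (simp add: divide_le_0_iff)
  then show ?thesis
    using vW v1 by (auto simp: w_def)
qed

text \<open>Induction over index sets replaces induction on the dimension. The next eigenvector is
  sought in the \<open>cdot\<close>-complement \<open>W\<close> of the previous ones, which is
  invariant because \<open>A\<close> is Hermitian and nonzero because the new index lies outside
  \<open>S\<close>.\<close>

lemma orthonormal_eigenvectors:
  fixes A :: "complex ^ 'n ^ 'n" and S :: "'n set"
  assumes herm: "hermitian A"
  shows "\<exists>u l. \<forall>i\<in>S. A *v u i = l i *\<^sub>R u i \<and> (\<forall>j\<in>S. cdot (u i) (u j) = (if i = j then 1 else 0))"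
  using finite[of S]
proof (induction S rule: finite_induct)
  case (insert i S)
  then obtain u :: "'n \<Rightarrow> complex^'n" and l :: "'n \<Rightarrow> real" where
    u: "\<And>i. i \<in> S \<Longrightarrow> A *v u i = l i *\<^sub>R u i"
       "\<And>i j. i \<in> S \<Longrightarrow> j \<in> S \<Longrightarrow> cdot (u i) (u j) = (if i = j then 1 else 0)"
    by metis
  define W where "W = {w. \<forall>j\<in>S. cdot (u j) w = 0}"
  have "subspace W"
    by (auto simp: subspace_def W_def cdot_add cdot_scaleR) (simp add: cdot_def)
  moreover have "A *v w \<in> W" if "w \<in> W" for w
    using that herm u(1) by (auto simp: W_def cdot_mult hermitian_def cdot_scaleR_left)
  moreover obtain v0 where "v0 \<in> W" "v0 \<noteq> 0"
    using exists_orthogonal[OF insert(2), of u] by (auto simp: W_def)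
  ultimately obtain v r where v: "v \<in> W" "norm v = 1" "A *v v = r *\<^sub>R v"
    using rayleigh_eigenvector[OF herm, of W v0] by blast
  have "cdot v v = 1" "\<And>j. j \<in> S \<Longrightarrow> cdot (u j) v = 0" 
    using v by (auto simp: cdot_self W_def)
  moreover have "cdot v (u j) = 0" if "j \<in> S" for j
    using v(1) that cnj_cdot[of "u j" v] by (simp add: W_def)
  ultimately show ?case
    using u v(3) insert(2)
    by (intro exI[of _ "u(i := v)"] exI[of _ "l(i := r)"]) auto
qed simp

lemma hermitian_diagonalization:
  fixes A :: "complex ^ 'n ^ 'n"
  assumes "hermitian A"
  obtains U l where "unitary U" "A = U ** real_diag l ** adjoint_mat U"
proof -
  obtain u :: "'n \<Rightarrow> complex^'n" and l :: "'n \<Rightarrow> real" where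
    u: "\<And>i. A *v u i = l i *\<^sub>R u i"
       "\<And>i j. cdot (u i) (u j) = (if i = j then 1 else 0)"
    using orthonormal_eigenvectors[OF assms, of UNIV] by (metis UNIV_I)
  define U :: "complex^'n^'n" where "U = (\<chi> i j. u j $ i)"
  have U1: "adjoint_mat U ** U = mat 1"
    using u(2) by (simp add: vec_eq_iff matrix_matrix_mult_def U_def mat_def cdot_def)
  then have U2: "U ** adjoint_mat U = mat 1"
    using matrix_left_right_inverse by blast
  have "(A ** U) $ i $ j = (U ** real_diag (\<chi> i. l i)) $ i $ j" for i j
  proof -
    have "(A ** U) $ i $ j = (A *v u j) $ i"
      by (simp add: matrix_matrix_mult_def matrix_vector_mult_def U_def)
    also have "\<dots> = l j *\<^sub>R u j $ i"
      by (simp add: u)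
    also have "\<dots> = (U ** real_diag (\<chi> i. l i)) $ i $ j"
      by (simp add: matrix_matrix_mult_def U_def real_diag_def if_distrib[of "(*) _"]
          scaleR_conv_of_real mult.commute cong: if_cong)
    finally show ?thesis .
  qed
  then have "A ** U = U ** real_diag (\<chi> i. l i)"
    by (simp add: vec_eq_iff)
  then have "A = U ** real_diag (\<chi> i. l i) ** adjoint_mat U"
    by (metis U2 matrix_mul_assoc matrix_mul_rid)
  then show ?thesis
    using that U1 U2 by (auto simp: unitary_def)
qed

section \<open>Functional calculus and Klein's inequality\<close>

text \<open>On Hermitian matrices the Hilbert-Schmidt product becomes the inner product of the
  matrix type, so bilinearity, continuity and the product rule for \<open>\<bullet>\<close> apply to
  traces.\<close>

lemma hs_inner_eq_inner: "hs_inner X Y = adjoint_mat X \<bullet> Y"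
proof -
  have "hs_inner X Y = (\<Sum>i\<in>UNIV. \<Sum>j\<in>UNIV. cnj (X $ i $ j) \<bullet> Y $ j $ i)"
    by (simp add: hs_inner_def trace_def matrix_matrix_mult_def inner_complex_def)
  also have "\<dots> = adjoint_mat X \<bullet> Y"
    by (subst sum.swap) (simp add: inner_vec_def)
  finally show ?thesis .
qed

lemma hs_inner_hermitian: "hermitian X \<Longrightarrow> hs_inner X Y = X \<bullet> Y"
  by (simp add: hs_inner_eq_inner hermitian_def)

lemma hs_inner_diff_right: "hs_inner X (Y - Z) = hs_inner X Y - hs_inner X Z"
  by (simp add: hs_inner_eq_inner inner_diff_right)

lemma rel_entropy_hermitian:
  "hermitian \<sigma> \<Longrightarrow> rel_entropy \<sigma> \<tau> = \<sigma> \<bullet> mat_log \<sigma> - \<sigma> \<bullet> mat_log \<tau>"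
  by (simp add: rel_entropy_def flip: hs_inner_def) (simp add: hs_inner_hermitian inner_diff_right)

definition diag_conj :: "complex ^ 'n ^ 'n \<Rightarrow> real ^ 'n \<Rightarrow> complex ^ 'n ^ 'n" where
  "diag_conj U l = U ** real_diag l ** adjoint_mat U"

definition vmap :: "(real \<Rightarrow> real) \<Rightarrow> real ^ 'n \<Rightarrow> real ^ 'n" where
  "vmap g l = (\<chi> i. g (l $ i))"

lemma vmap_nth [simp]: "vmap g l $ i = g (l $ i)"
  by (simp add: vmap_def)

lemma mult_real_diag_nth: "(A ** real_diag l) $ i $ j = A $ i $ j * complex_of_real (l $ j)"
  by (simp add: matrix_matrix_mult_def real_diag_def if_distrib[of "(*) _"] cong: if_cong)

lemma real_diag_mult_nth: "(real_diag l ** A) $ i $ j = complex_of_real (l $ i) * A $ i $ j"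
  by (simp add: matrix_matrix_mult_def real_diag_def if_distrib[of "\<lambda>x. x * _"] cong: if_cong)

lemma unitaryD:
  assumes "unitary U"
  shows "adjoint_mat U ** U = mat 1" "U ** adjoint_mat U = mat 1"
    "adjoint_mat U ** (U ** A) = A" "U ** (adjoint_mat U ** A) = A"
  using assms by (auto simp: unitary_def matrix_mul_assoc)

lemma unitary_adjoint_mat_mult: "unitary U \<Longrightarrow> unitary V \<Longrightarrow> unitary (adjoint_mat U ** V)"
  unfolding unitary_def
  by (simp add: adjoint_mat_mult) (metis matrix_mul_assoc matrix_mul_rid)

lemma hermitian_diag_conj [simp]: "hermitian (diag_conj U l)"
  by (simp add: hermitian_def diag_conj_def adjoint_mat_mult matrix_mul_assoc)

text \<open>The matrix \<open>W\<close> intertwines the two diagonal matrices. Entrywise,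
  \<open>W $ i $ j\<close> can be nonzero only if \<open>l $ j = m $ i\<close>, and then the values
  of \<open>g\<close> agree as well, so \<open>W\<close> also intertwines the transformed diagonals.
  This is what makes the description in \<open>herm_fun\<close> definite.\<close>

lemma diag_conj_vmap_unique:
  assumes U: "unitary U" and V: "unitary V" and eq: "diag_conj U l = diag_conj V m"
  shows "diag_conj U (vmap g l) = diag_conj V (vmap g m)"
proof -
  define W where "W = adjoint_mat V ** U"
  have "W ** real_diag l = adjoint_mat V ** diag_conj U l ** U"
    using U by (simp add: W_def diag_conj_def unitaryD flip: matrix_mul_assoc)
  also have "\<dots> = real_diag m ** W"
    unfolding eq using V by (simp add: W_def diag_conj_def unitaryD flip: matrix_mul_assoc)
  finally have "W $ i $ j * complex_of_real (l $ j) = complex_of_real (m $ i) * W $ i $ j" for i j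
    by (metis mult_real_diag_nth real_diag_mult_nth)
  then have "W $ i $ j = 0 \<or> l $ j = m $ i" for i j
    by (metis mult.commute mult_cancel_right of_real_eq_iff)
  then have "W $ i $ j * complex_of_real (g (l $ j)) = complex_of_real (g (m $ i)) * W $ i $ j" for i j
    by (metis mult.commute mult_zero_left)
  then have *: "W ** real_diag (vmap g l) = real_diag (vmap g m) ** W"
    by (simp add: vec_eq_iff mult_real_diag_nth real_diag_mult_nth)
  have "diag_conj U (vmap g l) = V ** (W ** real_diag (vmap g l)) ** adjoint_mat U"
    using V by (simp add: W_def diag_conj_def unitaryD flip: matrix_mul_assoc)
  also have "\<dots> = diag_conj V (vmap g m)"
    unfolding * using U by (simp add: W_def diag_conj_def unitaryD flip: matrix_mul_assoc)
  finally show ?thesis .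
qed

lemma herm_fun_diag_conj:
  assumes "unitary U"
  shows "herm_fun g (diag_conj U l) = diag_conj U (vmap g l)"
  unfolding herm_fun_def
proof (rule the_equality)
  show "\<exists>V m. unitary V \<and> diag_conj U l = V ** real_diag m ** adjoint_mat V \<and>
     diag_conj U (vmap g l) = V ** real_diag (\<chi> i. g (m $ i)) ** adjoint_mat V"
    using assms by (auto simp: diag_conj_def vmap_def)
next
  fix B
  assume "\<exists>V m. unitary V \<and> diag_conj U l = V ** real_diag m ** adjoint_mat V \<and>
     B = V ** real_diag (\<chi> i. g (m $ i)) ** adjoint_mat V"
  then obtain V m where "unitary V" "diag_conj U l = diag_conj V m" "B = diag_conj V (vmap g m)"
    by (auto simp: diag_conj_def vmap_def)
  then show "B = diag_conj U (vmap g l)"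
    using diag_conj_vmap_unique[OF assms] by metis
qed

lemma hermitian_imp_diag_conj:
  assumes "hermitian A"
  obtains U l where "unitary U" "A = diag_conj U l"
  using hermitian_diagonalization[OF assms] by (metis diag_conj_def)

lemma hermitian_herm_fun: "hermitian A \<Longrightarrow> hermitian (herm_fun g A)"
  by (metis hermitian_imp_diag_conj herm_fun_diag_conj hermitian_diag_conj)

lemma trace_diag_conj: 
  assumes "unitary U"
  shows "trace (diag_conj U l) = complex_of_real (\<Sum>i\<in>UNIV. l $ i)"
proof -
  have "trace (diag_conj U l) = trace (adjoint_mat U ** (U ** real_diag l))"
    unfolding diag_conj_def by (rule trace_mul_sym)
  then show ?thesis
    using assms by (simp add: unitaryD trace_def real_diag_def)
qed

lemma diag_conj_mult:
  assumes "unitary U"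
  shows "diag_conj U l ** diag_conj U m = diag_conj U (\<chi> i. l $ i * m $ i)"
proof -
  have "real_diag l ** real_diag m = real_diag (\<chi> i. l $ i * m $ i)"
    by (simp add: vec_eq_iff mult_real_diag_nth) (simp add: real_diag_def)
  then show ?thesis
    using assms by (simp add: diag_conj_def unitaryD flip: matrix_mul_assoc)
      (simp add: matrix_mul_assoc)
qed

text \<open>Together with the column version: the squared moduli of the entries of a unitary matrix
  are doubly stochastic, which supplies the weights for Klein's inequality.\<close>

lemma unitary_rows: 
  assumes "unitary W" shows "(\<Sum>j\<in>UNIV. (cmod (W $ i $ j))\<^sup>2) = 1"
proof -
  have "complex_of_real (\<Sum>j\<in>UNIV. (cmod (W $ i $ j))\<^sup>2) = (W ** adjoint_mat W) $ i $ i"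
    by (simp add: matrix_matrix_mult_def complex_norm_square del: of_real_power)
  also have "\<dots> = complex_of_real 1"
    using assms by (simp add: unitaryD mat_def)
  finally show ?thesis
    using of_real_eq_iff by blast
qed

lemma unitary_cols: 
  assumes "unitary W" shows "(\<Sum>i\<in>UNIV. (cmod (W $ i $ j))\<^sup>2) = 1"
proof -
  have "unitary (adjoint_mat W)"
    using assms by (simp add: unitary_def)
  from unitary_rows[OF this, of j] show ?thesis by simp
qed

text \<open>The weights are the squared overlaps of the two eigenbases. They turn the trace of a
  product of non-commuting matrices into a scalar sum over pairs of eigenvalues.\<close>

lemma trace_diag_conj_mult:
  assumes "unitary U" "unitary V"
  shows "trace (diag_conj U p ** diag_conj V q) = complex_of_real
    (\<Sum>i\<in>UNIV. \<Sum>j\<in>UNIV. (cmod ((adjoint_mat U ** V) $ i $ j))\<^sup>2 * (p $ i * q $ j))"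
proof -
  define W where "W = adjoint_mat U ** V"
  have "trace (diag_conj U p ** diag_conj V q)
      = trace (U ** (real_diag p ** W ** real_diag q ** adjoint_mat V))"
    by (simp add: diag_conj_def W_def matrix_mul_assoc)
  also have "\<dots> = trace (real_diag p ** W ** real_diag q ** adjoint_mat V ** U)"
    by (rule trace_mul_sym)
  also have "real_diag p ** W ** real_diag q ** adjoint_mat V ** U
      = (real_diag p ** W ** real_diag q) ** adjoint_mat W"
    by (simp add: W_def adjoint_mat_mult matrix_mul_assoc)
  also have "trace \<dots> = (\<Sum>i\<in>UNIV. \<Sum>j\<in>UNIV.
      complex_of_real (p $ i) * W $ i $ j * complex_of_real (q $ j) * cnj (W $ i $ j))"
    unfolding trace_def
    by (subst matrix_matrix_mult_def) (simp add: mult_real_diag_nth real_diag_mult_nth)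
  also have "\<dots> = complex_of_real
    (\<Sum>i\<in>UNIV. \<Sum>j\<in>UNIV. (cmod (W $ i $ j))\<^sup>2 * (p $ i * q $ j))"
    unfolding of_real_sum
    by (intro sum.cong refl) (simp add: complex_norm_square del: of_real_power)
  finally show ?thesis
    by (simp add: W_def)
qed

lemma quadratic_form_diag_conj:
  "v \<bullet> (diag_conj U l *v v) = (\<Sum>i\<in>UNIV. l $ i * (cmod ((adjoint_mat U *v v) $ i))\<^sup>2)"
proof -
  define w where "w = adjoint_mat U *v v"
  have "v \<bullet> (diag_conj U l *v v) = v \<bullet> (U *v (real_diag l *v w))"
    by (simp add: diag_conj_def w_def matrix_vector_mul_assoc matrix_mul_assoc)
  also have "\<dots> = w \<bullet> (real_diag l *v w)"
    by (simp add: inner_matrix_vector_mult w_def)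
  also have "real_diag l *v w = (\<chi> i. l $ i *\<^sub>R w $ i)"
    by (simp add: vec_eq_iff matrix_vector_mult_def real_diag_def if_distrib[of "\<lambda>x. x * _"]
       scaleR_conv_of_real cong: if_cong)
  also have "w \<bullet> \<dots> = (\<Sum>i\<in>UNIV. l $ i * (cmod (w $ i))\<^sup>2)"
    by (simp add: inner_vec_def power2_norm_eq_inner)
  finally show ?thesis by (simp add: w_def)
qed

text \<open>The witness is column \<open>i\<close> of \<open>U\<close>. It transfers bounds on the
  quadratic form to the spectrum.\<close>

lemma eigenvalue_eq_quadratic_form:
  assumes "unitary U"
  shows "\<exists>v. norm v = 1 \<and> v \<bullet> (diag_conj U l *v v) = l $ i"
proof -
  define v where "v = U *v axis i 1"
  have *: "adjoint_mat U *v v = axis i 1"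
    using assms by (simp add: v_def matrix_vector_mul_assoc unitaryD)
  have "v \<bullet> v = axis i (1::complex) \<bullet> axis i 1"
    by (metis * v_def inner_matrix_vector_mult)
  then have "norm v = 1"
    by (simp add: norm_eq_sqrt_inner inner_axis_axis)
  moreover have "v \<bullet> (diag_conj U l *v v) = (\<Sum>j\<in>UNIV. if j = i then l $ i else 0)"
    unfolding quadratic_form_diag_conj * by (intro sum.cong) (auto simp: axis_def)
  ultimately show ?thesis by (intro exI[of _ v]) auto
qed

lemma pos_semidef_diag_conj: 
  assumes "unitary U" "pos_semidef (diag_conj U l)"
  shows "0 \<le> l $ i"
proof -
  obtain v where "norm v = 1" "v \<bullet> (diag_conj U l *v v) = l $ i"
    using eigenvalue_eq_quadratic_form[OF assms(1)] by blast
  then show ?thesis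
    using assms(2) unfolding pos_semidef_def by metis
qed

lemma pos_def_diag_conj: 
  assumes "unitary U" "pos_def (diag_conj U l)"
  shows "0 < l $ i"
proof -
  obtain v where "norm v = 1" "v \<bullet> (diag_conj U l *v v) = l $ i"
    using eigenvalue_eq_quadratic_form[OF assms(1)] by blast
  moreover from this have "v \<noteq> 0" by auto
  ultimately show ?thesis
    using assms(2) unfolding pos_def_def by metis
qed

text \<open>Klein's inequality reduces to ln x \<le> x - 1 at x = q/p, multiplied by p and averaged
  with the doubly stochastic weights \<open>w\<close>. Row and column sums 1 collapse the lower
  bound to the difference of the two traces, which is 0.\<close>

lemma rel_entropy_nonneg:
  assumes \<rho>: "\<rho> \<in> states" and \<sigma>: "\<sigma> \<in> states" "pos_def \<sigma>"
  shows "0 \<le> rel_entropy \<rho> \<sigma>"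
proof -
  obtain U p where U: "unitary U" "\<rho> = diag_conj U p"
    using \<rho> by (auto simp: states_def pos_semidef_def elim: hermitian_imp_diag_conj)
  obtain V q where V: "unitary V" "\<sigma> = diag_conj V q"
    using \<sigma>(2) by (auto simp: pos_def_def elim: hermitian_imp_diag_conj)
  have p: "0 \<le> p $ i" for i
    using pos_semidef_diag_conj[OF U(1), of p i] \<rho> U(2) by (simp add: states_def)
  have q: "0 < q $ i" for i
    using pos_def_diag_conj[OF V(1), of q i] \<sigma> V(2) by simp
  have sums: "(\<Sum>i\<in>UNIV. p $ i) = 1" "(\<Sum>i\<in>UNIV. q $ i) = 1"
    using \<rho> \<sigma> trace_diag_conj[OF U(1), of p] trace_diag_conj[OF V(1), of q] U(2) V(2)
    by (metis (mono_tags) mem_Collect_eq of_real_eq_1_iff states_def)+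
  define w where "w i j = (cmod ((adjoint_mat U ** V) $ i $ j))\<^sup>2" for i j
  have W: "unitary (adjoint_mat U ** V)"
    using U V by (simp add: unitary_adjoint_mat_mult)
  have rows: "(\<Sum>j\<in>UNIV. w i j) = 1" and cols: "(\<Sum>i\<in>UNIV. w i j) = 1" for i j
    using unitary_rows[OF W] unitary_cols[OF W] by (simp_all add: w_def)
  have scalar: "p $ i - q $ j \<le> p $ i * ln (p $ i) - p $ i * ln (q $ j)" for i j
  proof (cases "p $ i = 0")
    case False
    then have pi: "p $ i > 0" using p[of i] by simp
    have "ln (q $ j / p $ i) \<le> q $ j / p $ i - 1"
      using pi q[of j] by (intro ln_le_minus_one) simp
    then have "p $ i * ln (q $ j / p $ i) \<le> p $ i * (q $ j / p $ i - 1)"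
      using pi by simp
    then show ?thesis
      using pi q[of j] by (simp add: ln_div algebra_simps)
  \<comment> \<open>For p = 0 both logarithmic terms carry the factor 0, and the claim is -q \<le>
    0.\<close>
  qed (use q[of j] in simp)
  have "rel_entropy \<rho> \<sigma> = Re (trace (\<rho> ** mat_log \<rho>)) - Re (trace (\<rho> ** mat_log \<sigma>))"
    by (simp add: rel_entropy_def flip: hs_inner_def) (simp add: hs_inner_diff_right)
  also have "Re (trace (\<rho> ** mat_log \<rho>)) = (\<Sum>i\<in>UNIV. p $ i * ln (p $ i))"
    using U(1) by (simp add: U(2) herm_fun_diag_conj diag_conj_mult trace_diag_conj)
  also have "\<dots> = (\<Sum>i\<in>UNIV. \<Sum>j\<in>UNIV. w i j * (p $ i * ln (p $ i)))"
    by (simp add: rows flip: sum_distrib_right)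
  also have "Re (trace (\<rho> ** mat_log \<sigma>)) = (\<Sum>i\<in>UNIV. \<Sum>j\<in>UNIV. w i j * (p $ i * ln (q $ j)))"
    using U V by (simp add: herm_fun_diag_conj trace_diag_conj_mult w_def del: Re_sum of_real_sum)
  also have "(\<Sum>i\<in>UNIV. \<Sum>j\<in>UNIV. w i j * (p $ i * ln (p $ i))) - \<dots>
     = (\<Sum>i\<in>UNIV. \<Sum>j\<in>UNIV. w i j * (p $ i * ln (p $ i) - p $ i * ln (q $ j)))"
    by (simp add: right_diff_distrib sum_subtractf)
  also have "\<dots> \<ge> (\<Sum>i\<in>UNIV. \<Sum>j\<in>UNIV. w i j * (p $ i - q $ j))"
    using scalar by (intro sum_mono mult_left_mono) (auto simp: w_def)
  also have "(\<Sum>i\<in>UNIV. \<Sum>j\<in>UNIV. w i j * (p $ i - q $ j))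
     = (\<Sum>i\<in>UNIV. (\<Sum>j\<in>UNIV. w i j) * p $ i) - (\<Sum>j\<in>UNIV. (\<Sum>i\<in>UNIV. w i j) * q $ j)"
    unfolding right_diff_distrib sum_subtractf sum_distrib_right
    by (subst (2) sum.swap) simp
  also have "\<dots> = 0"
    by (simp add: rows cols sums)
  finally show ?thesis by simp
qed

section \<open>Continuity of the functional calculus\<close>

text \<open>The Hermitian matrices with spectrum in [a, b], written as a continuous image so that
  compactness is inherited from the unitary group and a box.\<close>

definition spec_in :: "real \<Rightarrow> real \<Rightarrow> (complex ^ 'n ^ 'n) set" where
  "spec_in a b = (\<lambda>(U, l). diag_conj U l) ` (Collect unitary \<times> cbox (\<chi> i. a) (\<chi> i. b))"

lemma continuous_on_matrix_mult [continuous_intros]: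
  fixes f g :: "'a::topological_space \<Rightarrow> complex ^ 'n ^ 'n"
  assumes "continuous_on S f" "continuous_on S g"
  shows "continuous_on S (\<lambda>x. f x ** g x)"
  unfolding matrix_matrix_mult_def by (intro continuous_intros assms)

lemma continuous_on_adjoint_mat [continuous_intros]:
  "continuous_on S f \<Longrightarrow> continuous_on S (\<lambda>x. adjoint_mat (f x))"
  unfolding adjoint_mat_def by (intro continuous_intros)

lemma continuous_on_trace [continuous_intros]:
  fixes f :: "'a::topological_space \<Rightarrow> complex ^ 'n ^ 'n"
  shows "continuous_on S f \<Longrightarrow> continuous_on S (\<lambda>x. trace (f x))"
  unfolding trace_def by (intro continuous_intros)

lemma continuous_on_real_diag [continuous_intros]:
  fixes f :: "'a::topological_space \<Rightarrow> real ^ 'n"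
  assumes "continuous_on S f"
  shows "continuous_on S (\<lambda>x. real_diag (f x))"
  unfolding real_diag_def
proof (intro continuous_on_vec_lambda)
  fix i j :: 'n
  show "continuous_on S (\<lambda>x. if i = j then complex_of_real (f x $ i) else 0)"
    by (cases "i = j") (auto intro!: continuous_intros assms)
qed

lemma continuous_on_diag_conj [continuous_intros]:
  assumes "continuous_on S f" "continuous_on S g"
  shows "continuous_on S (\<lambda>x. diag_conj (f x) (g x))"
  unfolding diag_conj_def by (intro continuous_intros assms)

lemma compact_unitary: "compact (Collect unitary :: (complex ^ 'n ^ 'n) set)"
proof -
  have "norm U \<le> of_nat CARD('n)" if "unitary U" for U :: "complex ^ 'n ^ 'n"
  proof -
    have "norm (U $ i) = 1" for i
      using unitary_rows[OF that, of i] by (simp add: norm_vec_def L2_set_def)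
    then show ?thesis
      using L2_set_le_sum[of UNIV "\<lambda>i. norm (U $ i)"] by (simp add: norm_vec_def)
  qed
  then have "bounded (Collect unitary :: (complex ^ 'n ^ 'n) set)"
    by (auto simp: bounded_iff)
  moreover have "closed (Collect unitary :: (complex ^ 'n ^ 'n) set)"
    unfolding unitary_def by (intro closed_Collect_conj closed_Collect_eq continuous_intros)
  ultimately show ?thesis
    by (simp add: compact_eq_bounded_closed)
qed

lemma compact_spec_in: "compact (spec_in a b)"
  unfolding spec_in_def case_prod_unfold
  by (intro compact_continuous_image compact_Times compact_unitary compact_cbox continuous_intros)

text \<open>Both the graph of \<open>herm_fun g\<close> and its range are continuous images of the compact set of
  pairs of a unitary matrix and a spectrum in \<open>[a, b]\<close>.\<close>

lemma continuous_on_herm_fun: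
  fixes g :: "real \<Rightarrow> real"
  assumes "continuous_on {a..b} g"
  shows "continuous_on (spec_in a b :: (complex ^ 'n ^ 'n) set) (herm_fun g)"
proof -
  define K :: "((complex ^ 'n ^ 'n) \<times> (real ^ 'n)) set"
    where "K = Collect unitary \<times> cbox (\<chi> i. a) (\<chi> i. b)"
  have K: "compact K"
    unfolding K_def by (intro compact_Times compact_unitary compact_cbox)
  have "continuous_on K (\<lambda>x. g (snd x $ i))" for i
    by (rule continuous_on_compose2[OF assms])
      (auto intro!: continuous_intros simp: K_def mem_box_cart)
  then have cont: "continuous_on K (\<lambda>x. diag_conj (fst x) (vmap g (snd x)))"
    unfolding vmap_def by (intro continuous_intros)
  have spec: "spec_in a b = (\<lambda>x. diag_conj (fst x) (snd x)) ` K"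
    by (simp add: spec_in_def K_def case_prod_unfold)
  have fun_eq: "herm_fun g (diag_conj (fst x) (snd x)) = diag_conj (fst x) (vmap g (snd x))" if "x \<in> K" for x
    using that by (auto simp: K_def herm_fun_diag_conj)
  show ?thesis
  \<comment> \<open>A map into a compact set with closed graph is continuous. No eigenvectors
    depending continuously on the matrix are needed; at crossings of eigenvalues they need not
    exist.\<close>
  proof (rule continuous_from_closed_graph)
    show "compact ((\<lambda>x. diag_conj (fst x) (vmap g (snd x))) ` K)"
      by (intro compact_continuous_image cont K)
    show "herm_fun g \<in> spec_in a b \<rightarrow> (\<lambda>x. diag_conj (fst x) (vmap g (snd x))) ` K"
      unfolding spec by (rule funcsetI, elim imageE) (simp add: fun_eq)
    have graph: "(\<lambda>A. (A, herm_fun g A)) ` spec_in a b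
       = (\<lambda>x. (diag_conj (fst x) (snd x), diag_conj (fst x) (vmap g (snd x)))) ` K"
      unfolding spec image_image by (intro image_cong refl) (simp add: fun_eq)
    show "closed ((\<lambda>A. (A, herm_fun g A)) ` (spec_in a b :: (complex ^ 'n ^ 'n) set))"
      unfolding graph
      by (intro compact_imp_closed compact_continuous_image K continuous_intros cont)
  qed
qed

lemma spec_inI:
  assumes "hermitian A" "\<And>v. norm v = 1 \<Longrightarrow> a \<le> v \<bullet> (A *v v)" "\<And>v. norm v = 1 \<Longrightarrow> v \<bullet> (A *v v) \<le> b"
  shows "A \<in> spec_in a b"
proof -
  obtain U l where U: "unitary U" "A = diag_conj U l"
    using assms(1) by (rule hermitian_imp_diag_conj)
  have "a \<le> l $ i \<and> l $ i \<le> b" for i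
    using eigenvalue_eq_quadratic_form[OF U(1), of l i] assms(2,3) U(2) by metis
  then show ?thesis
    using U by (auto simp: spec_in_def mem_box_cart intro!: image_eqI[of _ _ "(U, l)"])
qed

section \<open>Compactness of the feasible set and existence of the AB minimizer\<close>

lemma states_hermitian: "\<rho> \<in> states \<Longrightarrow> hermitian \<rho>"
  by (simp add: states_def pos_semidef_def)

lemma states_diag_conj:
  assumes "\<rho> \<in> states"
  obtains U p where "unitary U" "\<rho> = diag_conj U p" "\<And>i. 0 \<le> p $ i" "\<And>i. p $ i \<le> 1"
proof -
  obtain U p where U: "unitary U" "\<rho> = diag_conj U p"
    using states_hermitian[OF assms] by (rule hermitian_imp_diag_conj)
  have p: "0 \<le> p $ i" for i
    using pos_semidef_diag_conj[OF U(1), of p i] assms U(2) by (simp add: states_def)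
  have "(\<Sum>i\<in>UNIV. p $ i) = 1"
    using assms trace_diag_conj[OF U(1), of p] U(2) 
    by (metis (mono_tags) mem_Collect_eq of_real_eq_1_iff states_def)
  then have "p $ i \<le> 1" for i
    using member_le_sum[of i UNIV "($) p"] p by simp
  with U p show ?thesis using that by blast
qed

lemma state_quadratic_form_le:
  assumes "\<rho> \<in> states" "norm v = 1"
  shows "v \<bullet> (\<rho> *v v) \<le> 1"
proof -
  obtain U p where U: "unitary U" "\<rho> = diag_conj U p" "\<And>i. 0 \<le> p $ i" "\<And>i. p $ i \<le> 1"
    using assms(1) by (rule states_diag_conj) blast
  define w where "w = adjoint_mat U *v v"
  have "v \<bullet> (\<rho> *v v) \<le> (\<Sum>i\<in>UNIV. 1 * (cmod (w $ i))\<^sup>2)"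
    unfolding U(2) quadratic_form_diag_conj w_def
    by (intro sum_mono mult_right_mono U) auto
  also have "\<dots> = w \<bullet> w"
    by (simp add: inner_vec_def power2_norm_eq_inner)
  also have "w \<bullet> w = v \<bullet> (U *v w)"
    by (simp add: w_def inner_matrix_vector_mult)
  also have "\<dots> = v \<bullet> v"
    using U(1) by (simp add: w_def matrix_vector_mul_assoc unitaryD)
  finally show ?thesis
    using assms(2) by (simp add: norm_eq_1)
qed

lemma states_subset_spec_in: "states \<subseteq> spec_in 0 1"
  by (auto intro!: spec_inI simp: state_quadratic_form_le states_hermitian)
    (simp add: states_def pos_semidef_def)

lemma continuous_on_matrix_vector_mult [continuous_intros]:
  fixes f :: "'a::topological_space \<Rightarrow> complex ^ 'n ^ 'n"
  assumes "continuous_on S f" "continuous_on S g"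
  shows "continuous_on S (\<lambda>x. f x *v g x)"
  unfolding matrix_vector_mult_def by (intro continuous_intros assms)

lemma compact_states: "compact (states :: (complex ^ 'n ^ 'n) set)"
proof -
  have "closed (states :: (complex ^ 'n ^ 'n) set)"
    unfolding states_def pos_semidef_def hermitian_def
    by (intro closed_Collect_conj closed_Collect_all closed_Collect_eq closed_Collect_le continuous_intros)
  then show ?thesis
    using compact_Int_closed[OF compact_spec_in[of 0 1]] states_subset_spec_in
    by (metis inf.absorb_iff2)
qed

lemma compact_feasible: "compact (feasible k H c)"
proof -
  have "closed {\<rho>. \<forall>j\<in>{1..k}. trace (\<rho> ** H j) = complex_of_real (c j)}"
    unfolding Ball_def
    by (intro closed_Collect_all closed_Collect_imp closed_Collect_eq continuous_intros) auto
  then have "compact (states \<inter> {\<rho>. \<forall>j\<in>{1..k}. trace (\<rho> ** H j) = complex_of_real (c j)})"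
    by (intro compact_Int_closed compact_states)
  then show ?thesis
    by (simp add: feasible_def Int_def)
qed

text \<open>At 0 the substitution y = 1/x turns x ln x into -(ln y)/y, which tends to 0 as y grows;
  this matches the value at 0 thanks to the factor x.\<close>

lemma continuous_on_mult_ln: "continuous_on {0..} (\<lambda>x::real. x * ln x)"
proof -
  have "((\<lambda>x::real. x * ln x) \<longlongrightarrow> 0) (at_right 0)"
  proof -
    have "((\<lambda>x::real. - (ln (inverse x) / inverse x)) \<longlongrightarrow> - 0) (at_right 0)"
      by (intro tendsto_minus filterlim_compose[OF ln_x_over_x_tendsto_0 filterlim_inverse_at_top_right])
    then show ?thesis
      by (simp add: ln_inverse divide_inverse mult.commute)
  qed
  then have "continuous (at 0 within {0..}) (\<lambda>x::real. x * ln x)"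
    by (simp add: continuous_within at_within_Ici_at_right)
  moreover have "continuous (at x within {0..}) (\<lambda>x::real. x * ln x)" if "x > 0" for x
    using that by (intro continuous_intros) auto
  ultimately show ?thesis
    unfolding continuous_on_eq_continuous_within by (metis atLeast_iff order_le_less)
qed

text \<open>The factor \<open>A\<close> is absorbed into the functional calculus because x ln x,
  unlike ln, is continuous on all of [0, 1], where the spectra of states lie.\<close>

lemma mult_mat_log:
  assumes "hermitian A"
  shows "A ** mat_log A = herm_fun (\<lambda>x. x * ln x) A"
proof -
  obtain U l where "unitary U" "A = diag_conj U l"
    using assms by (rule hermitian_imp_diag_conj)
  then show ?thesis
    by (simp add: herm_fun_diag_conj diag_conj_mult vmap_def)
qed

lemma continuous_on_rel_entropy: "continuous_on states (\<lambda>\<sigma>. rel_entropy \<sigma> \<tau>)"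
proof -
  have "continuous_on states (herm_fun (\<lambda>x. x * ln x))"
    by (rule continuous_on_subset[OF continuous_on_herm_fun states_subset_spec_in])
      (rule continuous_on_subset[OF continuous_on_mult_ln], auto)
  then have "continuous_on states (\<lambda>\<sigma>. Re (trace (herm_fun (\<lambda>x. x * ln x) \<sigma>)) - \<sigma> \<bullet> mat_log \<tau>)"
    by (intro continuous_intros)
  moreover have "rel_entropy \<sigma> \<tau> = Re (trace (herm_fun (\<lambda>x. x * ln x) \<sigma>)) - \<sigma> \<bullet> mat_log \<tau>" 
    if "\<sigma> \<in> states" for \<sigma>
    using states_hermitian[OF that]
    by (simp add: rel_entropy_hermitian flip: mult_mat_log hs_inner_def hs_inner_hermitian)
  ultimately show ?thesis
    by (simp cong: continuous_on_cong)
qed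

lemma feasible_subset_states: "feasible k H c \<subseteq> states"
  by (auto simp: feasible_def)

text \<open>The arbitrary choice made by \<open>arg_min\<close> is a minimizer only because one exists.\<close>

lemma AB_map_minimizes:
  assumes "feasible k H c \<noteq> {}" "\<sigma> \<in> feasible k H c"
  shows "rel_entropy (AB_map k H c \<gamma> \<Omega> \<rho>) (AB_target \<gamma> \<Omega> \<rho>) \<le> rel_entropy \<sigma> (AB_target \<gamma> \<Omega> \<rho>)"
proof -
  let ?D = "\<lambda>\<sigma>. rel_entropy \<sigma> (AB_target \<gamma> \<Omega> \<rho>)"
  obtain \<mu> where \<mu>: "\<mu> \<in> feasible k H c" "\<And>\<sigma>. \<sigma> \<in> feasible k H c \<Longrightarrow> ?D \<mu> \<le> ?D \<sigma>"
    using continuous_attains_inf[OF compact_feasible assms(1)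
        continuous_on_subset[OF continuous_on_rel_entropy feasible_subset_states]] by metis
  then have "is_arg_min ?D (\<lambda>\<sigma>. \<sigma> \<in> feasible k H c) \<mu>"
    by (auto simp: is_arg_min_linorder)
  then have "is_arg_min ?D (\<lambda>\<sigma>. \<sigma> \<in> feasible k H c) (AB_map k H c \<gamma> \<Omega> \<rho>)"
    unfolding AB_map_def arg_min_def by (rule someI)
  then show ?thesis
    using assms(2) by (auto simp: is_arg_min_linorder)
qed

section \<open>First-order optimality\<close>

lemma matrix_add_rdistrib: "(A + B) ** C = A ** C + B ** (C :: 'a::semiring_1 ^ 'n ^ 'm)"
  by (simp add: vec_eq_iff matrix_matrix_mult_def distrib_right sum.distrib)

lemma scaleR_matrix_mult_left: "(r *\<^sub>R A) ** B = r *\<^sub>R (A ** (B :: complex ^ 'n ^ 'n))"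
  by (simp add: vec_eq_iff matrix_matrix_mult_def scaleR_sum_right)

lemma scaleR_matrix_mult_right: "A ** (r *\<^sub>R B) = r *\<^sub>R (A ** (B :: complex ^ 'n ^ 'n))"
  by (simp add: vec_eq_iff matrix_matrix_mult_def scaleR_sum_right)

lemma scaleR_matrix_vector_mult: "(r *\<^sub>R A) *v v = r *\<^sub>R (A *v (v :: complex ^ 'n))"
  by (simp add: vec_eq_iff matrix_vector_mult_def scaleR_sum_right)

lemma trace_scaleR: "trace (r *\<^sub>R A) = r *\<^sub>R trace (A :: complex ^ 'n ^ 'n)"
  by (simp add: trace_def scaleR_sum_right)

lemma subspace_tangent: "subspace (tangent k H)"
  by (auto simp: subspace_def tangent_def hermitian_def adjoint_mat_add adjoint_mat_scaleR
      trace_add trace_scaleR matrix_add_rdistrib scaleR_matrix_mult_left)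
    (simp_all add: vec_eq_iff trace_def matrix_matrix_mult_def)

lemma feasible_add_tangent:
  assumes "\<rho> \<in> feasible k H c" "X \<in> tangent k H" "pos_semidef (\<rho> + t *\<^sub>R X)"
  shows "\<rho> + t *\<^sub>R X \<in> feasible k H c"
proof -
  have "t *\<^sub>R X \<in> tangent k H"
    using assms(2) subspace_tangent by (rule subspace_scale[rotated])
  then show ?thesis
    using assms by (auto simp: feasible_def states_def tangent_def trace_add matrix_add_rdistrib)
qed

lemma feasible_diff_tangent:
  assumes "\<rho> \<in> feasible k H c" "\<sigma> \<in> feasible k H c"
  shows "\<sigma> - \<rho> \<in> tangent k H"
proof -
  have "(\<sigma> - \<rho>) ** H j = \<sigma> ** H j - \<rho> ** H j" for j
    by (simp add: vec_eq_iff matrix_matrix_mult_def algebra_simps sum_subtractf)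
  then show ?thesis
    using assms by (auto simp: feasible_def tangent_def states_def pos_semidef_def hermitian_def
        adjoint_mat_diff trace_sub)
qed

text \<open>The uniform bound \<open>\<epsilon>\<close> is stronger than positivity: it keeps the
  spectra along a whole segment inside a compact interval on which ln is continuous.\<close>

lemma pos_def_perturb:
  fixes \<rho> X :: "complex ^ 'n ^ 'n"
  assumes "pos_def \<rho>"
  shows "\<exists>\<epsilon>>0. \<exists>\<delta>>0. \<forall>t v. \<bar>t\<bar> \<le> \<delta> \<longrightarrow> norm v = 1 \<longrightarrow> \<epsilon> \<le> v \<bullet> ((\<rho> + t *\<^sub>R X) *v v)"
proof -
  let ?S = "sphere 0 1 :: (complex ^ 'n) set"
  have "axis undefined 1 \<in> ?S" by (simp add: norm_axis_1)
  then have ne: "?S \<noteq> {}" by blast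
  have "continuous_on ?S (\<lambda>v. v \<bullet> (\<rho> *v v))" "continuous_on ?S (\<lambda>v. \<bar>v \<bullet> (X *v v)\<bar>)"
    by (intro continuous_intros)+
  note cont = this
  obtain v0 where v0: "v0 \<in> ?S" "\<And>v. v \<in> ?S \<Longrightarrow> v0 \<bullet> (\<rho> *v v0) \<le> v \<bullet> (\<rho> *v v)"
    using continuous_attains_inf[OF compact_sphere ne cont(1)] by blast
  obtain v1 where v1: "v1 \<in> ?S" "\<And>v. v \<in> ?S \<Longrightarrow> \<bar>v \<bullet> (X *v v)\<bar> \<le> \<bar>v1 \<bullet> (X *v v1)\<bar>"
    using continuous_attains_sup[OF compact_sphere ne cont(2)] by blast
  \<comment> \<open>\<open>m\<close> is the least value of the form of \<open>\<rho>\<close> on the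
    unit sphere, and \<open>C\<close> bounds that of \<open>X\<close>, with 1 added to make it
    positive. For |t| \<le> m / (2C) the perturbation costs at most m/2, so \<epsilon> = m/2
    remains.\<close>
  define m where "m = v0 \<bullet> (\<rho> *v v0)"
  define C where "C = \<bar>v1 \<bullet> (X *v v1)\<bar> + 1"
  have "m > 0"
    using assms v0(1) unfolding m_def pos_def_def by (metis mem_sphere_0 norm_zero zero_neq_one)
  have "C > 0" by (simp add: C_def)
  have "m / 2 \<le> v \<bullet> ((\<rho> + t *\<^sub>R X) *v v)" if t: "\<bar>t\<bar> \<le> m / (2 * C)" and v: "norm v = 1" for t v
  proof -
    have "\<bar>t * (v \<bullet> (X *v v))\<bar> \<le> m / (2 * C) * C"
      unfolding abs_mult using t v1(2)[of v] v by (intro mult_mono) (auto simp: C_def)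
    then have "\<bar>t * (v \<bullet> (X *v v))\<bar> \<le> m / 2"
      using \<open>C > 0\<close> by simp
    moreover have "m \<le> v \<bullet> (\<rho> *v v)"
      using v0(2)[of v] v by (simp add: m_def)
    moreover have "v \<bullet> ((\<rho> + t *\<^sub>R X) *v v) = v \<bullet> (\<rho> *v v) + t * (v \<bullet> (X *v v))"
      by (simp add: matrix_vector_mult_add_rdistrib inner_add_right scaleR_matrix_vector_mult)
    ultimately show ?thesis by linarith
  qed
  then show ?thesis
    using \<open>m > 0\<close> \<open>C > 0\<close> by (intro exI[of _ "m / 2"] conjI exI[of _ "m / (2 * C)"]) auto
qed

lemma pos_defI:
  fixes A :: "complex ^ 'n ^ 'n"
  assumes "hermitian A" "\<And>v. norm v = 1 \<Longrightarrow> 0 < v \<bullet> (A *v v)"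
  shows "pos_def A"
  unfolding pos_def_def
proof (intro conjI allI impI assms(1))
  fix v :: "complex ^ 'n"
  assume "v \<noteq> 0"
  then have "0 < ((1 / norm v) *\<^sub>R v) \<bullet> (A *v ((1 / norm v) *\<^sub>R v))"
    by (intro assms(2)) simp
  then show "0 < v \<bullet> (A *v v)"
    using \<open>v \<noteq> 0\<close> by (simp add: matrix_vector_mult_scaleR_right zero_less_divide_iff zero_less_mult_iff)
qed

lemma pos_def_imp_pos_semidef: "pos_def A \<Longrightarrow> pos_semidef A"
  unfolding pos_def_def pos_semidef_def by (metis inner_zero_left order.refl order_less_imp_le)

lemma feasible_pos_line:
  assumes \<rho>: "\<rho> \<in> feasible_pos k H c" and X: "X \<in> tangent k H"
  obtains \<epsilon> \<delta> where "\<epsilon> > 0" "\<delta> > 0"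
    "\<And>t. \<bar>t\<bar> \<le> \<delta> \<Longrightarrow> \<rho> + t *\<^sub>R X \<in> feasible_pos k H c"
    "\<And>t. \<bar>t\<bar> \<le> \<delta> \<Longrightarrow> \<rho> + t *\<^sub>R X \<in> spec_in \<epsilon> 1"
proof -
  obtain \<epsilon> \<delta> where \<epsilon>: "\<epsilon> > 0" "\<delta> > 0"
    and le: "\<And>t v. \<bar>t\<bar> \<le> \<delta> \<Longrightarrow> norm v = 1 \<Longrightarrow> \<epsilon> \<le> v \<bullet> ((\<rho> + t *\<^sub>R X) *v v)"
    using pos_def_perturb[of \<rho> X] \<rho> unfolding feasible_pos_def by blast
  have herm: "hermitian (\<rho> + t *\<^sub>R X)" for t
    using \<rho> X by (simp add: feasible_pos_def pos_def_def tangent_def hermitian_def adjoint_mat_add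
        adjoint_mat_scaleR)
  have pos: "\<rho> + t *\<^sub>R X \<in> feasible_pos k H c" if "\<bar>t\<bar> \<le> \<delta>" for t
  proof -
    have "pos_def (\<rho> + t *\<^sub>R X)"
      using \<open>\<epsilon> > 0\<close> le[OF that] herm by (intro pos_defI) force+
    then show ?thesis
      using feasible_add_tangent[of \<rho> k H c X t] \<rho> X
      by (simp add: feasible_pos_def pos_def_imp_pos_semidef)
  qed
  moreover have "\<rho> + t *\<^sub>R X \<in> spec_in \<epsilon> 1" if "\<bar>t\<bar> \<le> \<delta>" for t
    using le[OF that] pos[OF that] herm
    by (intro spec_inI state_quadratic_form_le) (auto simp: feasible_pos_def feasible_def)
  ultimately show ?thesis
    using that \<epsilon> by blast
qed

text \<open>Klein's inequality in the form \<open>D(\<rho> \<parallel> \<rho> + tX) \<ge> 0\<close> replaces differentiation of the entropy: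
  together with minimality it yields \<open>t Tr X (log (\<rho> + tX) - log \<tau>) \<ge> 0\<close>.\<close>

lemma rel_entropy_minimizer_nonneg:
  assumes \<rho>: "\<rho> \<in> feasible_pos k H c" and X: "X \<in> tangent k H"
    and min: "\<And>\<sigma>. \<sigma> \<in> feasible k H c \<Longrightarrow> rel_entropy \<rho> \<tau> \<le> rel_entropy \<sigma> \<tau>"
  shows "0 \<le> X \<bullet> (mat_log \<rho> - mat_log \<tau>)"
proof -
  obtain \<epsilon> \<delta> where \<epsilon>: "\<epsilon> > 0" and \<delta>: "\<delta> > 0"
    and pos: "\<And>t. \<bar>t\<bar> \<le> \<delta> \<Longrightarrow> \<rho> + t *\<^sub>R X \<in> feasible_pos k H c"
    and spec: "\<And>t. \<bar>t\<bar> \<le> \<delta> \<Longrightarrow> \<rho> + t *\<^sub>R X \<in> spec_in \<epsilon> 1"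
    using feasible_pos_line[OF \<rho> X] by metis
  define h where "h t = X \<bullet> (mat_log (\<rho> + t *\<^sub>R X) - mat_log \<tau>)" for t
  have "continuous_on {\<epsilon>..1} ln"
    using \<epsilon> by (intro continuous_on_ln continuous_on_id) auto
  then have "continuous_on {0..\<delta>} (\<lambda>t. mat_log (\<rho> + t *\<^sub>R X))"
    using spec \<epsilon>
    by (intro continuous_on_compose2[OF continuous_on_herm_fun[of \<epsilon> 1 ln]] continuous_intros) auto
  then have "continuous_on {0..\<delta>} h"
    unfolding h_def by (intro continuous_intros)
  then have lim: "(h \<longlongrightarrow> h 0) (at_right 0)"
    using \<delta> by (metis atLeastAtMost_iff at_within_Icc_at_right continuous_on order_less_imp_le order.refl)
  have "0 \<le> h t" if t: "0 < t" "t < \<delta>" for t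
  proof -
    define r where "r = \<rho> + t *\<^sub>R X"
    have r: "r \<in> feasible_pos k H c"
      using pos[of t] t by (simp add: r_def)
    then have st: "\<rho> \<in> states" "r \<in> states" "pos_def r" "r \<in> feasible k H c"
      using \<rho> by (auto simp: feasible_pos_def feasible_def)
    have "0 \<le> \<rho> \<bullet> mat_log \<rho> - \<rho> \<bullet> mat_log r"
      using rel_entropy_nonneg[OF st(1-3)] st(1) by (simp add: rel_entropy_hermitian states_hermitian)
    moreover have "\<rho> \<bullet> mat_log \<rho> - \<rho> \<bullet> mat_log \<tau> \<le> r \<bullet> mat_log r - r \<bullet> mat_log \<tau>"
      using min[OF st(4)] st(1,2) by (simp add: rel_entropy_hermitian states_hermitian)
    \<comment> \<open>The right-hand side is
      \<open>D(r||\<tau>) - D(\<rho>||\<tau>) + D(\<rho>||r)\<close>: the difference is nonnegative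
      by minimality, the last term by Klein's inequality.\<close>
    moreover have "t * h t = r \<bullet> mat_log r - r \<bullet> mat_log \<tau> - (\<rho> \<bullet> mat_log r - \<rho> \<bullet> mat_log \<tau>)"
      unfolding h_def by (simp add: inner_diff_right algebra_simps flip: r_def)
        (simp add: r_def inner_add_left algebra_simps)
    ultimately have "0 \<le> t * h t" by linarith
    then show ?thesis using t by (simp add: zero_le_mult_iff)
  qed
  then have "\<forall>\<^sub>F t in at_right 0. 0 \<le> h t"
    using \<delta> by (auto simp: eventually_at_right_field)
  then have "0 \<le> h 0"
    using lim by (intro tendsto_lowerbound) auto
  then show ?thesis by (simp add: h_def)
qed

text \<open>The one-sided inequality is applied to \<open>X\<close> and to \<open>- X\<close>, both
  tangent.\<close>

lemma rel_entropy_minimizer_stationary: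
  assumes \<rho>: "\<rho> \<in> feasible_pos k H c" and X: "X \<in> tangent k H"
    and min: "\<And>\<sigma>. \<sigma> \<in> feasible k H c \<Longrightarrow> rel_entropy \<rho> \<tau> \<le> rel_entropy \<sigma> \<tau>"
  shows "X \<bullet> (mat_log \<rho> - mat_log \<tau>) = 0"
  using rel_entropy_minimizer_nonneg[OF \<rho> X min]
    rel_entropy_minimizer_nonneg[OF \<rho> subspace_neg[OF subspace_tangent X] min]
  by simp

section \<open>Logarithm of the AB target and the fixed-point condition\<close>

lemma diag_conj_scaleR: "r *\<^sub>R diag_conj U l = diag_conj U (r *\<^sub>R l)"
proof -
  have "real_diag (r *\<^sub>R l) = r *\<^sub>R real_diag l"
    by (simp add: vec_eq_iff real_diag_def complex_eq_iff)
  then show ?thesis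
    by (simp add: diag_conj_def scaleR_matrix_mult_left scaleR_matrix_mult_right)
qed

lemma diag_conj_diff: "diag_conj U (l - m) = diag_conj U l - diag_conj U m"
  by (simp add: diag_conj_def vec_eq_iff matrix_matrix_mult_def real_diag_def
      left_diff_distrib right_diff_distrib sum_subtractf if_distrib[of "(*) _"] cong: if_cong)

lemma diag_conj_const:
  fixes U :: "complex ^ 'n ^ 'n"
  assumes "unitary U"
  shows "diag_conj U (\<chi> i. r) = r *\<^sub>R mat 1"
proof -
  have "real_diag (\<chi> i. 1) = (mat 1 :: complex ^ 'n ^ 'n)"
    by (simp add: real_diag_def mat_def vec_eq_iff)
  then have one: "diag_conj U (\<chi> i. 1) = mat 1"
    using assms by (simp add: diag_conj_def unitaryD)
  have "diag_conj U (\<chi> i. r) = diag_conj U (r *\<^sub>R (\<chi> i. 1))"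
    by (rule arg_cong[of _ _ "diag_conj U"]) (simp add: vec_eq_iff)
  then show ?thesis
    by (simp add: one flip: diag_conj_scaleR)
qed

text \<open>On the eigenvalues ln undoes exp, and division by \<open>Z\<close> shifts all of them by
  the same amount, hence the multiple of the identity. \<open>Z\<close> is positive as a sum of
  exponentials.\<close>

lemma mat_log_normalized_exp:
  fixes K :: "complex ^ 'n ^ 'n"
  assumes "hermitian K"
  defines "Z \<equiv> Re (trace (mat_exp K))"
  shows "mat_log ((1 / Z) *\<^sub>R mat_exp K) = K - ln Z *\<^sub>R mat 1"
proof -
  obtain V q where V: "unitary V" "K = diag_conj V q"
    using assms(1) by (rule hermitian_imp_diag_conj)
  have e: "mat_exp K = diag_conj V (vmap exp q)"
    using V by (simp add: herm_fun_diag_conj)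
  have Z: "Z > 0"
    unfolding Z_def e trace_diag_conj[OF V(1)] by (simp add: sum_pos)
  have "vmap ln ((1 / Z) *\<^sub>R vmap exp q) = q - (\<chi> i. ln Z)"
    using Z by (simp add: vec_eq_iff ln_div)
  then show ?thesis
    unfolding e diag_conj_scaleR herm_fun_diag_conj[OF V(1)]
    using V by (simp add: diag_conj_diff diag_conj_const)
qed

lemma AB_fixed_point_orthogonal:
  assumes \<gamma>: "\<gamma> > 0" and \<rho>: "\<rho> \<in> feasible_pos k H c" and herm: "hermitian (\<Omega> \<rho>)"
    and fp: "AB_map k H c \<gamma> \<Omega> \<rho> = \<rho>" and X: "X \<in> tangent k H"
  shows "X \<bullet> \<Omega> \<rho> = 0"
proof -
  define K where "K = mat_log \<rho> - (1 / \<gamma>) *\<^sub>R \<Omega> \<rho>"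
  have \<rho>': "\<rho> \<in> feasible k H c" "hermitian \<rho>"
    using \<rho> by (auto simp: feasible_pos_def pos_def_def)
  have "hermitian K"
    using hermitian_herm_fun[OF \<rho>'(2), of ln] herm
    by (simp add: K_def hermitian_def adjoint_mat_diff adjoint_mat_scaleR)
  from mat_log_normalized_exp[OF this]
  have log: "mat_log (AB_target \<gamma> \<Omega> \<rho>) = K - ln (Re (trace (mat_exp K))) *\<^sub>R mat 1"
    by (simp add: AB_target_def K_def Let_def)
  \<comment> \<open>By the fixed-point equation the minimizer in \<open>AB_map_minimizes\<close> is
    \<open>\<rho>\<close> itself.\<close>
  have "X \<bullet> (mat_log \<rho> - mat_log (AB_target \<gamma> \<Omega> \<rho>)) = 0"
    using AB_map_minimizes[of k H c _ \<gamma> \<Omega> \<rho>] fp \<rho>'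
    by (intro rel_entropy_minimizer_stationary[OF \<rho> X]) auto
  \<comment> \<open>Tangent directions are traceless, so they do not see the normalization
    constant.\<close>
  moreover have "X \<bullet> mat 1 = 0"
    using X hs_inner_hermitian[of X "mat 1"] by (simp add: tangent_def hs_inner_def)
  ultimately have "X \<bullet> ((1 / \<gamma>) *\<^sub>R \<Omega> \<rho>) = 0"
    unfolding log K_def by (simp add: inner_diff_right inner_add_right)
  then show ?thesis using \<gamma> by simp
qed

section \<open>Derivatives along feasible lines\<close>

lemma objective_line_derivative:
  assumes "hermitian \<rho>" "hermitian X" "dir_differentiable \<Omega> \<rho> X"
  shows "((\<lambda>t. objective \<Omega> (\<rho> + t *\<^sub>R X)) has_vector_derivative
    (\<rho> \<bullet> dir_deriv \<Omega> \<rho> X + X \<bullet> \<Omega> \<rho>)) (at 0)"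
proof -
  have "((\<lambda>t. \<Omega> (\<rho> + t *\<^sub>R X)) has_vector_derivative dir_deriv \<Omega> \<rho> X) (at 0)"
    using assms(3) unfolding dir_differentiable_def dir_deriv_def
    by (simp flip: vector_derivative_works)
  moreover have "((\<lambda>t. \<rho> + t *\<^sub>R X) has_vector_derivative X) (at 0)"
    by (auto intro!: derivative_eq_intros)
  ultimately have "((\<lambda>t. (\<rho> + t *\<^sub>R X) \<bullet> \<Omega> (\<rho> + t *\<^sub>R X)) has_vector_derivative
    ((\<rho> + 0 *\<^sub>R X) \<bullet> dir_deriv \<Omega> \<rho> X + X \<bullet> \<Omega> (\<rho> + 0 *\<^sub>R X))) (at 0)"
    by (intro bounded_bilinear.has_vector_derivative[OF bounded_bilinear_inner])
  moreover have "objective \<Omega> (\<rho> + t *\<^sub>R X) = (\<rho> + t *\<^sub>R X) \<bullet> \<Omega> (\<rho> + t *\<^sub>R X)" for t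
    using assms by (simp add: objective_def hermitian_def adjoint_mat_add adjoint_mat_scaleR
        flip: hs_inner_def) (simp add: hs_inner_eq_inner adjoint_mat_add adjoint_mat_scaleR)
  ultimately show ?thesis by simp
qed

text \<open>The bounded linear map \<open>?L\<close> annihilates \<open>\<Omega>\<close> along the
  line near 0 and commutes with differentiation. This is for the imaginary part of the complex trace
  in (d3) and (d4), since the derivative of the real function \<open>f\<close> determines only the
  real part.\<close>

lemma hermitian_dir_deriv:
  fixes \<Omega> :: "complex ^ 'n ^ 'n \<Rightarrow> complex ^ 'n ^ 'n"
  assumes diff: "dir_differentiable \<Omega> \<rho> X" and "\<delta> > 0"
    and herm: "\<And>t. \<bar>t\<bar> \<le> \<delta> \<Longrightarrow> hermitian (\<Omega> (\<rho> + t *\<^sub>R X))"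
  shows "hermitian (dir_deriv \<Omega> \<rho> X)"
proof -
  let ?L = "\<lambda>A :: complex ^ 'n ^ 'n. A - adjoint_mat A"
  have "linear ?L"
    by (simp add: linear_iff adjoint_mat_add adjoint_mat_scaleR algebra_simps)
  then have "bounded_linear ?L"
    by (rule linear_conv_bounded_linear[THEN iffD1])
  moreover have "((\<lambda>t. \<Omega> (\<rho> + t *\<^sub>R X)) has_vector_derivative dir_deriv \<Omega> \<rho> X) (at 0)"
    using diff unfolding dir_differentiable_def dir_deriv_def
    by (simp flip: vector_derivative_works)
  ultimately have "((\<lambda>t. ?L (\<Omega> (\<rho> + t *\<^sub>R X))) has_vector_derivative ?L (dir_deriv \<Omega> \<rho> X)) (at 0)"
    by (rule bounded_linear.has_vector_derivative)
  then have "((\<lambda>t. 0) has_vector_derivative ?L (dir_deriv \<Omega> \<rho> X)) (at 0)"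
    by (rule has_vector_derivative_transform_within_open[where S = "{-\<delta><..<\<delta>}"])
      (use \<open>\<delta> > 0\<close> herm in \<open>auto simp: hermitian_def\<close>)
  then have "?L (dir_deriv \<Omega> \<rho> X) = 0"
    using has_vector_derivative_const vector_derivative_unique_at by blast
  then show ?thesis
    by (simp add: hermitian_def)
qed

lemma trace_mult_hermitian_real:
  assumes "hermitian A" "hermitian B"
  shows "Im (trace (A ** B)) = 0"
proof -
  have "cnj (trace (A ** B)) = trace (adjoint_mat (A ** B))"
    by (simp add: trace_def)
  also have "\<dots> = trace (B ** A)"
    using assms by (simp add: adjoint_mat_mult hermitian_def)
  also have "\<dots> = trace (A ** B)"
    by (rule trace_mul_sym)
  finally show ?thesis
    by (simp add: complex_eq_iff)
qed

text \<open>The chain rule is applied within a closed interval that the line maps into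
  \<open>S\<close>. The interval is a neighbourhood of 0, so a derivative relative to
  \<open>S\<close> yields an unrestricted two-sided one.\<close>

lemma line_derivative_of_differentiable:
  fixes f :: "'a::real_normed_vector \<Rightarrow> real"
  assumes f: "(f has_derivative f') (at x within S)" and "\<delta> > 0"
    and line: "\<And>t. \<bar>t\<bar> \<le> \<delta> \<Longrightarrow> x + t *\<^sub>R X \<in> S"
  shows "((\<lambda>t. f (x + t *\<^sub>R X)) has_vector_derivative f' X) (at 0)"
proof -
  let ?I = "{-\<delta>..\<delta>}"
  have X: "((\<lambda>t. x + t *\<^sub>R X) has_derivative (\<lambda>t. t *\<^sub>R X)) (at 0 within ?I)"
    by (auto intro!: derivative_eq_intros)
  have "(f has_derivative f') (at (x + 0 *\<^sub>R X) within (\<lambda>t. x + t *\<^sub>R X) ` ?I)"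
    using line by (auto intro!: has_derivative_subset[OF f])
  from diff_chain_within[OF X this]
  have "((\<lambda>t. f (x + t *\<^sub>R X)) has_derivative (\<lambda>t. f' (t *\<^sub>R X))) (at 0 within ?I)"
    by (simp add: o_def)
  moreover have "f' (t *\<^sub>R X) = t *\<^sub>R f' X" for t
    using f by (simp add: has_derivative_linear linear_scale)
  moreover have "at 0 within ?I = at (0::real)"
    using \<open>\<delta> > 0\<close> by (intro at_within_Icc_at) auto
  ultimately show ?thesis
    by (simp add: has_vector_derivative_def)
qed

text \<open>By convexity every difference quotient with 0 < t < 1 is at most f y - f x, and the
  quotients tend to 0.\<close>

lemma convex_on_stationary_imp_le:
  fixes f :: "'a::real_normed_vector \<Rightarrow> real"
  assumes "convex_on S f" "x \<in> S" "y \<in> S"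
    and "((\<lambda>t. f (x + t *\<^sub>R (y - x))) has_vector_derivative 0) (at 0)"
  shows "f x \<le> f y"
proof -
  have "((\<lambda>t. (f (x + t *\<^sub>R (y - x)) - f x) / t) \<longlongrightarrow> 0) (at 0)"
    using assms(4) by (simp add: has_real_derivative_iff_has_vector_derivative[symmetric] DERIV_def)
  then have lim: "((\<lambda>t. (f (x + t *\<^sub>R (y - x)) - f x) / t) \<longlongrightarrow> 0) (at_right 0)"
    by (simp add: filterlim_at_split)
  have "(f (x + t *\<^sub>R (y - x)) - f x) / t \<le> f y - f x" if "0 < t" "t < 1" for t
  proof -
    have "f ((1 - t) *\<^sub>R x + t *\<^sub>R y) \<le> (1 - t) * f x + t * f y"
      using assms(1-3) that by (intro convex_onD) auto
    moreover have "(1 - t) *\<^sub>R x + t *\<^sub>R y = x + t *\<^sub>R (y - x)"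
      by (simp add: algebra_simps)
    ultimately show ?thesis
      using that by (simp add: field_simps)
  qed
  then have "\<forall>\<^sub>F t in at_right 0. (f (x + t *\<^sub>R (y - x)) - f x) / t \<le> f y - f x"
    by (auto simp: eventually_at_right_field intro!: exI[of _ 1])
  from tendsto_upperbound[OF lim this] show ?thesis by simp
qed

section \<open>Equivalence of the four conditions\<close>

theorem corollary13:
  fixes H :: "nat \<Rightarrow> complex ^ 'n ^ 'n" and c :: "nat \<Rightarrow> real" and k m :: nat
    and \<Omega> :: "complex ^ 'n ^ 'n \<Rightarrow> complex ^ 'n ^ 'n" and \<gamma> :: real
    and \<rho>s :: "complex ^ 'n ^ 'n" and E :: "nat \<Rightarrow> complex ^ 'n ^ 'n"
  assumes H_herm: "\<forall>j\<in>{1..k}. hermitian (H j)"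
    and H_inj: "inj_on H {1..k}" "mat 1 \<notin> H ` {1..k}"
    and H_indep: "independent (insert (mat 1) (H ` {1..k}))"
    and M_pos: "feasible_pos k H c \<noteq> {}"
    and Omega_herm: "\<forall>\<rho>\<in>states. hermitian (\<Omega> \<rho>)"
    and Omega_cont: "continuous_on states \<Omega>"
    and gamma: "\<gamma> > 0"
    and f_convex: "convex_on (feasible k H c) (objective \<Omega>)"
    and f_diff: "objective \<Omega> differentiable_on feasible k H c"
    and rho_mem: "\<rho>s \<in> feasible_pos k H c"
    and rho_fixed: "AB_map k H c \<gamma> \<Omega> \<rho>s = \<rho>s"
    and Omega_diff: "\<forall>X\<in>tangent k H. dir_differentiable \<Omega> \<rho>s X"
    and m_eq: "m = CARD('n)\<^sup>2 - k - 1"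
    and E_basis: "hs_orthonormal_basis m E (tangent k H)"
  defines "d1 \<equiv> \<forall>\<sigma>\<in>feasible k H c. objective \<Omega> \<rho>s \<le> objective \<Omega> \<sigma>"
    and "d2 \<equiv> \<forall>X\<in>tangent k H. dir_deriv (objective \<Omega>) \<rho>s X = 0"
    and "d3 \<equiv> \<forall>X\<in>tangent k H. trace (\<rho>s ** dir_deriv \<Omega> \<rho>s X) = 0"
    and "d4 \<equiv> \<forall>a\<in>{1..m}. trace (\<rho>s ** dir_deriv \<Omega> \<rho>s (E a)) = 0"
  shows "(d1 \<longleftrightarrow> d2) \<and> (d2 \<longleftrightarrow> d3) \<and> (d3 \<longleftrightarrow> d4)"
proof -
  let ?f = "objective \<Omega>" and ?M = "feasible k H c" and ?T = "tangent k H"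
  have rho: "\<rho>s \<in> ?M" "\<rho>s \<in> states" "hermitian \<rho>s"
    using rho_mem by (auto simp: feasible_pos_def feasible_def states_hermitian)
  \<comment> \<open>Differentiability within the feasible set determines \<open>f'\<close> only on
    the tangent space, and it is evaluated only there. Its linearity later carries vanishing from
    the basis to the span.\<close>
  obtain f' where f': "(?f has_derivative f') (at \<rho>s within ?M)"
    using f_diff rho(1) by (auto simp: differentiable_on_def differentiable_def)
  have line: "\<exists>\<delta>>0. \<forall>t. \<bar>t\<bar> \<le> \<delta> \<longrightarrow> \<rho>s + t *\<^sub>R X \<in> ?M" if "X \<in> ?T" for X
    using feasible_pos_line[OF rho_mem that] unfolding feasible_pos_def by (metis (no_types, lifting) mem_Collect_eq)
  have deriv: "((\<lambda>t. ?f (\<rho>s + t *\<^sub>R X)) has_vector_derivative f' X) (at 0)" if "X \<in> ?T" for X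
    using line[OF that] line_derivative_of_differentiable[OF f'] by blast
  have dd: "dir_deriv ?f \<rho>s X = f' X" if "X \<in> ?T" for X
    unfolding dir_deriv_def using deriv[OF that] by (rule vector_derivative_at)
  \<comment> \<open>The real part comes from two computations of one line derivative, by
    differentiability of \<open>f\<close> and by the product rule; the imaginary part vanishes
    because the derivative of \<open>\<Omega>\<close> is Hermitian.\<close>
  have tr: "trace (\<rho>s ** dir_deriv \<Omega> \<rho>s X) = complex_of_real (f' X)" if X: "X \<in> ?T" for X
  proof -
    have "X \<bullet> \<Omega> \<rho>s = 0"
      using AB_fixed_point_orthogonal[OF gamma rho_mem _ rho_fixed X] Omega_herm rho(2) by blast
    then have "((\<lambda>t. ?f (\<rho>s + t *\<^sub>R X)) has_vector_derivative \<rho>s \<bullet> dir_deriv \<Omega> \<rho>s X) (at 0)"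
      using objective_line_derivative[OF rho(3), of X \<Omega>] Omega_diff X by (simp add: tangent_def)
    then have "\<rho>s \<bullet> dir_deriv \<Omega> \<rho>s X = f' X"
      using deriv[OF X] vector_derivative_unique_at by blast
    then have "Re (trace (\<rho>s ** dir_deriv \<Omega> \<rho>s X)) = f' X"
      using hs_inner_hermitian[OF rho(3)] by (simp add: hs_inner_def)
    moreover obtain \<delta> where "\<delta> > 0" "\<And>t. \<bar>t\<bar> \<le> \<delta> \<Longrightarrow> \<rho>s + t *\<^sub>R X \<in> ?M"
      using line[OF X] by blast
    then have "hermitian (dir_deriv \<Omega> \<rho>s X)"
      using Omega_diff X Omega_herm feasible_subset_states by (intro hermitian_dir_deriv) blast+
    then have "Im (trace (\<rho>s ** dir_deriv \<Omega> \<rho>s X)) = 0"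
      by (rule trace_mult_hermitian_real[OF rho(3)])
    ultimately show ?thesis
      by (simp add: complex_eq_iff)
  qed
  have span: "span (E ` {1..m}) = ?T"
    using E_basis by (simp add: hs_orthonormal_basis_def)
  have ET: "E a \<in> ?T" if "a \<in> {1..m}" for a
    unfolding span[symmetric] by (intro span_base imageI that)
  have d2: "d2 \<longleftrightarrow> (\<forall>X\<in>?T. f' X = 0)" and d3: "d3 \<longleftrightarrow> (\<forall>X\<in>?T. f' X = 0)"
    by (auto simp: d2_def d3_def dd tr)
  have d4: "d4 \<longleftrightarrow> (\<forall>a\<in>{1..m}. f' (E a) = 0)"
    using ET by (auto simp: d4_def tr)
  have "f' X = 0" if "\<forall>a\<in>{1..m}. f' (E a) = 0" "X \<in> ?T" for X
    using that(2) unfolding span[symmetric]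
    by (rule linear_eq_0_on_span[OF has_derivative_linear[OF f'], rotated]) (use that(1) in auto)
  then have d34: "d3 \<longleftrightarrow> d4"
    unfolding d3 d4 using ET by blast
  \<comment> \<open>Fermat's rule applies because the line through \<open>\<rho>s\<close> is
    feasible on both sides of t = 0.\<close>
  have "f' X = 0" if d1 and X: "X \<in> ?T" for X
  proof -
    obtain \<delta> where "\<delta> > 0" "\<And>t. \<bar>t\<bar> \<le> \<delta> \<Longrightarrow> \<rho>s + t *\<^sub>R X \<in> ?M"
      using line[OF X] by blast
    then show ?thesis
      using deriv[OF X] \<open>d1\<close>
      by (intro DERIV_local_min[of "\<lambda>t. ?f (\<rho>s + t *\<^sub>R X)" "f' X" 0 \<delta>])
        (auto simp: has_real_derivative_iff_has_vector_derivative d1_def)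
  qed
  moreover have d1 if "\<forall>X\<in>?T. f' X = 0"
    unfolding d1_def
  proof
    fix \<sigma> assume \<sigma>: "\<sigma> \<in> ?M"
    then have "\<sigma> - \<rho>s \<in> ?T"
      by (rule feasible_diff_tangent[OF rho(1)])
    then show "?f \<rho>s \<le> ?f \<sigma>"
      using deriv that \<sigma> by (intro convex_on_stationary_imp_le[OF f_convex rho(1)]) force+
  qed
  ultimately have "d1 \<longleftrightarrow> d2"
    unfolding d2 by blast
  with d34 d2 d3 show ?thesis by blast
qed

end
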